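(* Let $n\ge 2$ and let $\Lambda$ be the preprojective algebra of type $A_{n-1}$. Let $A$ and $B$ be proper subsets of $\{1,\dots,n\}$ of sizes $i$ and $j$ respectively, with $A\neq\{1,\dots,i\}$ and $B\neq\{1,\dots,j\}$. Then $$\max_{x\in P(B)}\langle 1_A,x\rangle=\dim\operatorname{Hom}_\Lambda(N(A),N(B)),$$ where $N(A),N(B)$ are the Maya modules, $P(B)$ is the truncated permutahedron of $B$, and $\langle\cdot,\cdot\rangle$ is the standard inner product on $\mathbb{R}^n$.
   Context: Fix a ground field. Let $I=\{1,\dots,n-1\}$. A (finite-dimensional) $\Lambda$-module is an $I$-graded finite-dimensional vector space $M=\bigoplus_{i\in I}M_i$ with linear maps $(i\to i+1):M_i\to M_{i+1}$ (for $1\le i\le n-2$) and $(i\to i-1):M_i\to M_{i-1}$ (for $2\le i\le n-1$) satisfying, for every $i\in I$, $$(i+1\to i)\circ(i\to i+1)=(i-1\to i)\circ(i\to i-1)\quad\text{on } M_i,$$ with the convention $M_0=M_n=0$, so that $(1\to 0)$ and $(n-1\to n)$ are zero. Homomorphisms are graded linear maps commuting with all these maps. Maya modules: let $A=\{a_1<\dots<a_i\}$ be a proper subset of $\{1,\dots,n\}$ of size $i$ with $A\ne\{1,\dots,i\}$. $N(A)$ has basis $\{w_{j,k}: 1\le k\le i,\ k\le j\le a_k-1\}$ with $w_{j,k}\in N(A)_j$, and $$(j\to j-1)(w_{j,k})=w_{j-1,k},\qquad (j\to j+1)(w_{j,k})=w_{j+1,k+1},$$ where $w_{j,k}$ is interpreted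 as $0$ whenever $(j,k)$ is not in the index set of the basis. For $A\subseteq\{1,\dots,n\}$, $1_A\in\mathbb{R}^n$ is the indicator vector of $A$. For $B=\{b_1<\dots<b_j\}\subseteq\{1,\dots,n\}$, the truncated permutahedron is the convex hull $$P(B)=\operatorname{conv}\bigl\{1_C-1_{\{1,\dots,j\}}: C=\{c_1<\dots<c_j\}\subseteq\{1,\dots,n\},\ c_k\le b_k\text{ for all }k=1,\dots,j\bigr\}\subset\mathbb{R}^n.$$ *)

theory Defs
  imports "HOL-Analysis.Analysis" "HOL-Library.Function_Algebras"
begin

section \<open>Modules over the preprojective algebra of type \<open>A\<^bsub>n-1\<^esub>\<close>\<close>

definition linear_on ::
  "('k \<Rightarrow> 'v \<Rightarrow> 'v) \<Rightarrow> ('k \<Rightarrow> 'w \<Rightarrow> 'w) \<Rightarrow> 'v set \<Rightarrow> 'w set \<Rightarrow> ('v::ab_group_add \<Rightarrow> 'w::ab_group_add) \<Rightarrow> bool"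
  where "linear_on s t V W f \<longleftrightarrow> f ` V \<subseteq> W
    \<and> (\<forall>x\<in>V. \<forall>y\<in>V. f (x + y) = f x + f y) \<and> (\<forall>c. \<forall>x\<in>V. f (s c x) = t c (f x))"

text \<open>The homogeneous components \<open>M\<^sub>i\<close> are subspaces \<open>grade M i\<close> of an ambient vector space
  \<open>'v\<close> with scalar multiplication \<open>smul M\<close>; the graded space is their external direct sum.
  \<open>up M i\<close> is the map \<open>i \<rightarrow> i + 1\<close> and \<open>down M i\<close> is the map \<open>i \<rightarrow> i - 1\<close>; only their values on
  \<open>grade M i\<close> matter.\<close>

record ('k, 'v) graded_rep =
  smul :: "'k \<Rightarrow> 'v \<Rightarrow> 'v"
  grade :: "nat \<Rightarrow> 'v set"
  up :: "nat \<Rightarrow> 'v \<Rightarrow> 'v"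
  down :: "nat \<Rightarrow> 'v \<Rightarrow> 'v"

text \<open>The convention \<open>M\<^sub>0 = M\<^sub>n = 0\<close> is imposed literally, so the maps into these two components
  vanish.\<close>

definition lambda_module :: "nat \<Rightarrow> ('k::field, 'v::ab_group_add) graded_rep \<Rightarrow> bool"
  where "lambda_module n M \<longleftrightarrow>
    vector_space (smul M)
    \<and> (\<forall>i\<in>{1..n-1}. module.subspace (smul M) (grade M i)
          \<and> (\<exists>S. finite S \<and> grade M i = module.span (smul M) S))
    \<and> grade M 0 = {0} \<and> grade M n = {0}
    \<and> (\<forall>i\<in>{0..n-1}. linear_on (smul M) (smul M) (grade M i) (grade M (i+1)) (up M i))
    \<and> (\<forall>i\<in>{1..n}. linear_on (smul M) (smul M) (grade M i) (grade M (i-1)) (down M i))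
    \<and> (\<forall>i\<in>{1..n-1}. \<forall>x\<in>grade M i. down M (i+1) (up M i x) = up M (i-1) (down M i x))"

text \<open>A homomorphism is a family \<open>(f\<^sub>i)\<close> of linear maps on the components. To make such
  families correspond one-to-one to HOL functions, \<open>f i\<close> is set to \<open>0\<close> outside \<open>grade M i\<close>, and
  entirely for \<open>i \<notin> {1..n-1}\<close>.\<close>

definition Hom_Lambda ::
  "nat \<Rightarrow> ('k::field, 'v::ab_group_add) graded_rep \<Rightarrow> ('k, 'w::ab_group_add) graded_rep
    \<Rightarrow> (nat \<Rightarrow> 'v \<Rightarrow> 'w) set"
  where "Hom_Lambda n M N = {f.
    (\<forall>i\<in>{1..n-1}. linear_on (smul M) (smul N) (grade M i) (grade N i) (f i))
    \<and> (\<forall>i x. i \<notin> {1..n-1} \<or> x \<notin> grade M i \<longrightarrow> f i x = 0)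
    \<and> (\<forall>i. 1 \<le> i \<and> i + 2 \<le> n \<longrightarrow> (\<forall>x\<in>grade M i. f (i+1) (up M i x) = up N i (f i x)))
    \<and> (\<forall>i. 2 \<le> i \<and> i + 1 \<le> n \<longrightarrow> (\<forall>x\<in>grade M i. f (i-1) (down M i x) = down N i (f i x)))}"

definition hom_smul ::
  "('k, 'w) graded_rep \<Rightarrow> 'k \<Rightarrow> (nat \<Rightarrow> 'v \<Rightarrow> 'w) \<Rightarrow> (nat \<Rightarrow> 'v \<Rightarrow> 'w)"
  where "hom_smul N c f = (\<lambda>i x. smul N c (f i x))"

definition dim_Hom ::
  "nat \<Rightarrow> ('k::field, 'v::ab_group_add) graded_rep \<Rightarrow> ('k, 'w::ab_group_add) graded_rep \<Rightarrow> nat"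
  where "dim_Hom n M N = vector_space.dim (hom_smul N) (Hom_Lambda n M N)"


section \<open>Maya modules\<close>

text \<open>\<open>kth A k\<close> is \<open>a\<^sub>k\<close>, for \<open>A = {a\<^sub>1 < \<dots> < a\<^sub>i}\<close> and \<open>1 \<le> k \<le> i\<close>.\<close>

definition kth :: "nat set \<Rightarrow> nat \<Rightarrow> nat"
  where "kth A k = sorted_list_of_set A ! (k - 1)"

definition maya_index :: "nat set \<Rightarrow> (nat \<times> nat) set"
  where "maya_index A = {(j, k). 1 \<le> k \<and> k \<le> card A \<and> k \<le> j \<and> j \<le> kth A k - 1}"

definition maya_smul :: "'k::field \<Rightarrow> (nat \<times> nat \<Rightarrow> 'k) \<Rightarrow> (nat \<times> nat \<Rightarrow> 'k)"
  where "maya_smul c x = (\<lambda>p. c * x p)"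

text \<open>The vector \<open>w\<^bsub>j,k\<^esub>\<close>, which is \<open>0\<close> off the index set.\<close>

definition maya_vec :: "nat set \<Rightarrow> nat \<Rightarrow> nat \<Rightarrow> (nat \<times> nat \<Rightarrow> 'k::field)"
  where "maya_vec A j k = (\<lambda>p. if (j, k) \<in> maya_index A \<and> p = (j, k) then 1 else 0)"

text \<open>Elements of \<open>N(A)\<close> are represented by their coordinate functions with respect to the basis
  \<open>w\<^bsub>j,k\<^esub>\<close>; the structure maps are the linear extensions of the prescribed values on the basis.\<close>

definition maya_module :: "nat set \<Rightarrow> ('k::field, nat \<times> nat \<Rightarrow> 'k) graded_rep"
  where "maya_module A = \<lparr>
    smul = maya_smul,
    grade = (\<lambda>j. {x. \<forall>p. x p \<noteq> 0 \<longrightarrow> p \<in> maya_index A \<and> fst p = j}),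
    up = (\<lambda>j x. \<Sum>k\<in>{k. (j, k) \<in> maya_index A}. maya_smul (x (j, k)) (maya_vec A (j+1) (k+1))),
    down = (\<lambda>j x. \<Sum>k\<in>{k. (j, k) \<in> maya_index A}. maya_smul (x (j, k)) (maya_vec A (j-1) k))\<rparr>"


section \<open>Truncated permutahedra\<close>

text \<open>The space \<open>\<real>\<^sup>n\<close> is realised as the functions \<open>nat \<Rightarrow> real\<close> vanishing outside \<open>{1..n}\<close>, with
  pointwise operations.\<close>

instantiation "fun" :: (type, real_vector) real_vector
begin

definition scaleR_fun_def: "r *\<^sub>R f = (\<lambda>x. r *\<^sub>R f x)"

instance
  by standard (simp_all add: scaleR_fun_def fun_eq_iff scaleR_add_right scaleR_add_left)

end

definition trunc_perm :: "nat \<Rightarrow> nat set \<Rightarrow> (nat \<Rightarrow> real) set"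
  where "trunc_perm n B = convex hull
    {indicator C - indicator {1..card B} | C.
      C \<subseteq> {1..n} \<and> card C = card B \<and> (\<forall>k\<in>{1..card B}. kth C k \<le> kth B k)}"

definition inner_n :: "nat \<Rightarrow> (nat \<Rightarrow> real) \<Rightarrow> (nat \<Rightarrow> real) \<Rightarrow> real"
  where "inner_n n x y = (\<Sum>m=1..n. x m * y m)"

definition is_maximum_on :: "('a \<Rightarrow> real) \<Rightarrow> 'a set \<Rightarrow> real \<Rightarrow> bool"
  where "is_maximum_on f S m \<longleftrightarrow> (\<exists>x\<in>S. f x = m) \<and> (\<forall>x\<in>S. f x \<le> m)"


section \<open>Well-definedness\<close>

lemma vector_space_maya_smul: "vector_space (maya_smul :: 'k::field \<Rightarrow> _)"
  by unfold_locales (simp_all add: maya_smul_def fun_eq_iff algebra_simps)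

lemma vector_space_hom_smul:
  assumes "vector_space (smul N)"
  shows "vector_space (hom_smul N :: 'k::field \<Rightarrow> (nat \<Rightarrow> 'v \<Rightarrow> 'w::ab_group_add) \<Rightarrow> _)"
proof -
  interpret vector_space "smul N" by (fact assms)
  show ?thesis
    by unfold_locales (simp_all add: hom_smul_def fun_eq_iff scale_right_distrib scale_left_distrib)
qed

lemma subspace_Hom_Lambda:
  assumes M: "lambda_module n M" and N: "lambda_module n N"
  shows "module.subspace (hom_smul N) (Hom_Lambda n M N)"
proof -
  interpret N: vector_space "smul N" using N by (simp add: lambda_module_def)
  interpret H: vector_space "hom_smul N" by (rule vector_space_hom_smul) unfold_locales
  have sub: "N.subspace (grade N i)" if "i \<in> {1..n-1}" for i
    using N that by (simp add: lambda_module_def)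
  have upN: "linear_on (smul N) (smul N) (grade N i) (grade N (i+1)) (up N i)"
    if "i \<in> {1..n-1}" for i
  proof -
    have "i \<in> {0..n-1}" using that by simp
    then show ?thesis using N unfolding lambda_module_def by blast
  qed
  have dnN: "linear_on (smul N) (smul N) (grade N i) (grade N (i-1)) (down N i)"
    if "i \<in> {1..n-1}" for i
  proof -
    have "i \<in> {1..n}" using that by auto
    then show ?thesis using N unfolding lambda_module_def by blast
  qed
  have comb: "(\<lambda>i x. smul N c (f i x) + smul N d (g i x)) \<in> Hom_Lambda n M N" (is "?h \<in> _")
    if f: "f \<in> Hom_Lambda n M N" and g: "g \<in> Hom_Lambda n M N" for c d f g
  proof -
    have lin: "linear_on (smul M) (smul N) (grade M i) (grade N i) (f i)"
              "linear_on (smul M) (smul N) (grade M i) (grade N i) (g i)"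
      if "i \<in> {1..n-1}" for i using f g that unfolding Hom_Lambda_def by blast+
    have mem: "f i x \<in> grade N i" "g i x \<in> grade N i" if "i \<in> {1..n-1}" "x \<in> grade M i" for i x
      using lin[OF that(1)] that(2) unfolding linear_on_def by blast+
    have mem': "smul N c (f i x) \<in> grade N i" "smul N d (g i x) \<in> grade N i"
      if "i \<in> {1..n-1}" "x \<in> grade M i" for i x
      using mem[OF that] sub[OF that(1)] by (simp_all add: N.subspace_scale)
    have hlin: "linear_on (smul M) (smul N) (grade M i) (grade N i) (?h i)" if i: "i \<in> {1..n-1}" for i
      unfolding linear_on_def
    proof (intro conjI ballI allI)
      show "?h i ` grade M i \<subseteq> grade N i"
        using mem'[OF i] N.subspace_add[OF sub[OF i]] by auto
    next
      fix x y assume "x \<in> grade M i" "y \<in> grade M i"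
      then have "f i (x + y) = f i x + f i y" "g i (x + y) = g i x + g i y"
        using lin[OF i] unfolding linear_on_def by blast+
      then show "?h i (x + y) = ?h i x + ?h i y" by (simp add: N.scale_right_distrib)
    next
      fix a x assume "x \<in> grade M i"
      then have "f i (smul M a x) = smul N a (f i x)" "g i (smul M a x) = smul N a (g i x)"
        using lin[OF i] unfolding linear_on_def by blast+
      then show "?h i (smul M a x) = smul N a (?h i x)"
        by (simp add: N.scale_right_distrib mult.commute)
    qed
    have zero: "?h i x = 0" if "i \<notin> {1..n-1} \<or> x \<notin> grade M i" for i x
    proof -
      have "f i x = 0" "g i x = 0" using f g that unfolding Hom_Lambda_def by blast+
      then show ?thesis by simp
    qed
    have hup: "?h (i+1) (up M i x) = up N i (?h i x)"
      if i: "1 \<le> i \<and> i + 2 \<le> n" and x: "x \<in> grade M i" for i x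
    proof -
      have i': "i \<in> {1..n-1}" using i by auto
      have "f (i+1) (up M i x) = up N i (f i x)" "g (i+1) (up M i x) = up N i (g i x)"
        using f g i x unfolding Hom_Lambda_def by blast+
      moreover have "up N i (?h i x) = up N i (smul N c (f i x)) + up N i (smul N d (g i x))"
        "up N i (smul N c (f i x)) = smul N c (up N i (f i x))"
        "up N i (smul N d (g i x)) = smul N d (up N i (g i x))"
        using upN[OF i'] mem[OF i' x] mem'[OF i' x] unfolding linear_on_def by blast+
      ultimately show ?thesis by simp
    qed
    have hdn: "?h (i-1) (down M i x) = down N i (?h i x)"
      if i: "2 \<le> i \<and> i + 1 \<le> n" and x: "x \<in> grade M i" for i x
    proof -
      have i': "i \<in> {1..n-1}" using i by auto
      have "f (i-1) (down M i x) = down N i (f i x)" "g (i-1) (down M i x) = down N i (g i x)"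
        using f g i x unfolding Hom_Lambda_def by blast+
      moreover have "down N i (?h i x) = down N i (smul N c (f i x)) + down N i (smul N d (g i x))"
        "down N i (smul N c (f i x)) = smul N c (down N i (f i x))"
        "down N i (smul N d (g i x)) = smul N d (down N i (g i x))"
        using dnN[OF i'] mem[OF i' x] mem'[OF i' x] unfolding linear_on_def by blast+
      ultimately show ?thesis by simp
    qed
    show ?thesis
      unfolding Hom_Lambda_def mem_Collect_eq
      by (intro conjI ballI allI impI) (fact hlin zero hup hdn)+
  qed
  show ?thesis
    unfolding H.subspace_def
  proof (intro conjI ballI allI)
    have "up N i 0 = 0" "down N i 0 = 0" if i: "i \<in> {1..n-1}" for i
    proof -
      have 0: "0 \<in> grade N i" using sub[OF i] by (rule N.subspace_0)
      then have "up N i (smul N 0 0) = smul N 0 (up N i 0)"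
        "down N i (smul N 0 0) = smul N 0 (down N i 0)"
        using upN[OF i] dnN[OF i] unfolding linear_on_def by blast+
      then show "up N i 0 = 0" "down N i 0 = 0" by simp_all
    qed
    then show "0 \<in> Hom_Lambda n M N"
      using sub unfolding Hom_Lambda_def linear_on_def
      by (auto simp: image_subset_iff N.subspace_0)
  next
    fix f g assume "f \<in> Hom_Lambda n M N" "g \<in> Hom_Lambda n M N"
    from comb[OF this, of 1 1] show "f + g \<in> Hom_Lambda n M N" by (simp add: plus_fun_def)
  next
    fix c f assume "f \<in> Hom_Lambda n M N"
    from comb[OF this this, of c 0] show "hom_smul N c f \<in> Hom_Lambda n M N"
      by (simp add: hom_smul_def)
  qed
qed

lemma kth_less_kth:
  assumes "finite A" "1 \<le> k" "k < l" "l \<le> card A"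
  shows "kth A k < kth A l"
  unfolding kth_def using assms
  by (intro sorted_wrt_nth_less[OF strict_sorted_list_of_set]) auto

lemma kth_in:
  assumes "finite A" "1 \<le> k" "k \<le> card A"
  shows "kth A k \<in> A"
proof -
  have "k - 1 < length (sorted_list_of_set A)" using assms by simp
  then show ?thesis unfolding kth_def using assms(1) by (metis nth_mem set_sorted_list_of_set)
qed

lemma lambda_module_maya:
  fixes A :: "nat set"
  assumes A: "A \<subseteq> {1..n}" and n: "n \<ge> 2"
  shows "lambda_module n (maya_module A :: ('k::field, nat \<times> nat \<Rightarrow> 'k) graded_rep)"
proof -
  let ?I = "maya_index A"
  let ?M = "maya_module A :: ('k, nat \<times> nat \<Rightarrow> 'k) graded_rep"
  interpret V: vector_space "maya_smul :: 'k \<Rightarrow> _" by (rule vector_space_maya_smul)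
  have finA: "finite A" using A finite_subset by blast
  have kn: "1 \<le> kth A k" "kth A k \<le> n" if "1 \<le> k" "k \<le> card A" for k
    using kth_in[OF finA that] A by auto
  have Ij: "1 \<le> j \<and> j \<le> n - 1" if "(j, k) \<in> ?I" for j k
    using that kn[of k] unfolding maya_index_def by auto
  have fin: "finite {k. (j, k) \<in> ?I}" for j
    by (rule finite_subset[of _ "{..card A}"]) (auto simp: maya_index_def)
  have up: "up ?M j x = (\<lambda>(j', k'). if j' = j + 1 \<and> 1 \<le> k' \<and> (j', k') \<in> ?I \<and> (j, k' - 1) \<in> ?I
      then x (j, k' - 1) else 0)" (is "_ = ?u") for j x
  proof (rule ext)
    fix p :: "nat \<times> nat"
    obtain j' k' where p: "p = (j', k')" by (cases p)
    have "up ?M j x p = (\<Sum>k\<in>{k. (j, k) \<in> ?I}. x (j, k) * maya_vec A (j+1) (k+1) p)"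
      unfolding maya_module_def
      by (simp, induction rule: finite_induct[OF fin[of j]]) (simp_all add: maya_smul_def)
    also have "\<dots> = (\<Sum>k\<in>{k. (j, k) \<in> ?I}. if k = k' - 1 then ?u p else 0)"
      by (rule sum.cong) (auto simp: maya_vec_def p)
    also have "\<dots> = ?u p" using fin[of j] by (auto simp: p)
    finally show "up ?M j x p = ?u p" .
  qed
  have dn: "down ?M j x = (\<lambda>(j', k'). if j' = j - 1 \<and> (j', k') \<in> ?I \<and> (j, k') \<in> ?I
      then x (j, k') else 0)" (is "_ = ?d") for j x
  proof (rule ext)
    fix p :: "nat \<times> nat"
    obtain j' k' where p: "p = (j', k')" by (cases p)
    have "down ?M j x p = (\<Sum>k\<in>{k. (j, k) \<in> ?I}. x (j, k) * maya_vec A (j-1) k p)"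
      unfolding maya_module_def
      by (simp, induction rule: finite_induct[OF fin[of j]]) (simp_all add: maya_smul_def)
    also have "\<dots> = (\<Sum>k\<in>{k. (j, k) \<in> ?I}. if k = k' then ?d p else 0)"
      by (rule sum.cong) (auto simp: maya_vec_def p)
    also have "\<dots> = ?d p" using fin[of j] by (auto simp: p)
    finally show "down ?M j x p = ?d p" .
  qed
  have gr: "grade ?M j = {x. \<forall>p. x p \<noteq> 0 \<longrightarrow> p \<in> ?I \<and> fst p = j}" for j
    by (simp add: maya_module_def)
  have sm: "smul ?M = maya_smul" by (simp add: maya_module_def)
  have sub: "V.subspace (grade ?M j)" for j
    unfolding V.subspace_def gr by (auto simp: maya_smul_def) (metis add.right_neutral)+
  have spn: "grade ?M j = V.span ((\<lambda>k. maya_vec A j k) ` {k. (j, k) \<in> ?I})" for j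
  proof
    show "V.span ((\<lambda>k. maya_vec A j k) ` {k. (j, k) \<in> ?I}) \<subseteq> grade ?M j"
      by (rule V.span_minimal[OF _ sub]) (auto simp: gr maya_vec_def split: if_splits)
    show "grade ?M j \<subseteq> V.span ((\<lambda>k. maya_vec A j k) ` {k. (j, k) \<in> ?I})"
    proof
      fix x assume x: "x \<in> grade ?M j"
      have "x = (\<Sum>k\<in>{k. (j, k) \<in> ?I}. maya_smul (x (j, k)) (maya_vec A j k))" (is "_ = ?s")
      proof
        fix p :: "nat \<times> nat"
        obtain j' k' where p: "p = (j', k')" by (cases p)
        have "?s p = (\<Sum>k\<in>{k. (j, k) \<in> ?I}. x (j, k) * maya_vec A j k p)"
          by (induction rule: finite_induct[OF fin[of j]]) (simp_all add: maya_smul_def)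
        also have "\<dots> = (\<Sum>k\<in>{k. (j, k) \<in> ?I}. if k = k' then x p else 0)"
          using x by (intro sum.cong) (auto simp: maya_vec_def p gr)
        also have "\<dots> = x p" using fin[of j] x by (auto simp: p gr)
        finally show "x p = ?s p" by simp
      qed
      also have "\<dots> \<in> V.span ((\<lambda>k. maya_vec A j k) ` {k. (j, k) \<in> ?I})"
        by (intro V.span_sum V.span_scale V.span_base) auto
      finally show "x \<in> V.span ((\<lambda>k. maya_vec A j k) ` {k. (j, k) \<in> ?I})" .
    qed
  qed
  have zero: "grade ?M j = {0}" if "j = 0 \<or> j = n" for j
  proof -
    have "{k. (j, k) \<in> ?I} = {}" using that Ij[of j] n by force
    then show ?thesis by (simp add: spn)
  qed
  have lup: "linear_on maya_smul maya_smul (grade ?M j) (grade ?M (j+1)) (up ?M j)" for j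
  proof -
    have "up ?M j x \<in> grade ?M (j+1)" for x unfolding up gr by (auto split: if_splits)
    moreover have "up ?M j (x + y) = up ?M j x + up ?M j y" for x y
      unfolding up fun_eq_iff split_paired_All by auto
    moreover have "up ?M j (maya_smul c x) = maya_smul c (up ?M j x)" for c x
      unfolding up maya_smul_def fun_eq_iff split_paired_All by auto
    ultimately show ?thesis unfolding linear_on_def by blast
  qed
  have ldn: "linear_on maya_smul maya_smul (grade ?M j) (grade ?M (j-1)) (down ?M j)" for j
  proof -
    have "down ?M j x \<in> grade ?M (j-1)" for x unfolding dn gr by (auto split: if_splits)
    moreover have "down ?M j (x + y) = down ?M j x + down ?M j y" for x y
      unfolding dn fun_eq_iff split_paired_All by auto
    moreover have "down ?M j (maya_smul c x) = maya_smul c (down ?M j x)" for c x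
      unfolding dn maya_smul_def fun_eq_iff split_paired_All by auto
    ultimately show ?thesis unfolding linear_on_def by blast
  qed
  have rel: "down ?M (j+1) (up ?M j x) = up ?M (j-1) (down ?M j x)"
    if "j \<in> {1..n-1}" "x \<in> grade ?M j" for j x
  proof (rule ext)
    fix p :: "nat \<times> nat"
    obtain j' k' where p: "p = (j', k')" by (cases p)
    have "(j + 1, k') \<in> ?I \<and> (j, k' - 1) \<in> ?I \<longleftrightarrow> (j - 1, k' - 1) \<in> ?I \<and> (j, k' - 1) \<in> ?I"
      if "(j, k') \<in> ?I"
    proof (cases "k' \<ge> 2")
      case True
      then show ?thesis
        using that kth_less_kth[OF finA, of "k' - 1" k'] unfolding maya_index_def by (auto; arith)
    next
      case False
      then show ?thesis unfolding maya_index_def by auto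
    qed
    then show "down ?M (j+1) (up ?M j x) p = up ?M (j-1) (down ?M j x) p"
      using \<open>j \<in> {1..n-1}\<close> by (auto simp: up dn p)
  qed
  show ?thesis
    unfolding lambda_module_def sm
  proof (intro conjI ballI)
    fix j show "\<exists>S. finite S \<and> grade ?M j = V.span S"
      using spn[of j] fin[of j] by blast
  qed (use V.vector_space_axioms sub zero lup ldn rel in blast)+
qed

end

theory Submission
  imports Defs
begin

text \<open>Let \<open>R\<close> be the largest \<open>r\<close> such that the \<open>r\<close> smallest elements of \<open>A\<close> lie termwise below
  the \<open>r\<close> largest elements of \<open>B\<close>, and put \<open>j = card B\<close>. Both sides equal \<open>R - card (A \<inter> {1..j})\<close>.

  The linear functional is maximised at a vertex given by some \<open>C\<close>, where its value is
  \<open>card (A \<inter> C) - card (A \<inter> {1..j})\<close>. Interlacing gives \<open>card (A \<inter> C) \<le> R\<close>, with equality for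
  \<open>C = {a\<^sub>1, \<dots>, a\<^sub>R} \<union> {1..q}\<close> when \<open>q\<close> is chosen such that \<open>card C = j\<close>.

  The socle of \<open>N(B)\<close> is spanned by \<open>w\<^bsub>j,j\<^esub>\<close>, so a homomorphism is determined by its matrix
  coefficients from \<open>w\<^bsub>j,r\<^esub>\<close> to \<open>w\<^bsub>j,j\<^esub>\<close>. Pulling such a coefficient back along paths in \<open>N(A)\<close>
  shows that it vanishes unless \<open>r \<le> R\<close>, and \<open>w\<^bsub>j,r\<^esub>\<close> is nonzero exactly if
  \<open>card (A \<inter> {1..j}) < r \<le> card A\<close> and \<open>r \<le> j\<close>. Conversely, for each remaining \<open>r\<close> the shift
  \<open>w\<^bsub>q,k\<^esub> \<mapsto> w\<^bsub>q,k+j-r\<^esub>\<close> is a homomorphism, and these shifts form the dual basis.\<close>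


section \<open>Order statistics of finite sets\<close>

lemma inj_on_kth: "finite A \<Longrightarrow> inj_on (kth A) {1..card A}"
  by (rule linorder_inj_onI) (use kth_less_kth in fastforce)+

lemma kth_image:
  assumes "finite A"
  shows "kth A ` {1..card A} = A"
  using inj_on_kth[OF assms] kth_in[OF assms] assms by (intro card_subset_eq) (auto simp: card_image)

text \<open>Trades order statistics for counting, so that later comparisons of \<open>kth\<close>
  reduce to inclusions of finite sets.\<close>

lemma kth_le_iff:
  assumes "finite C" "1 \<le> k" "k \<le> card C"
  shows "kth C k \<le> m \<longleftrightarrow> k \<le> card {c\<in>C. c \<le> m}"
proof
  assume le: "kth C k \<le> m"
  have "kth C ` {1..k} \<subseteq> {c\<in>C. c \<le> m}"
  proof
    fix c assume "c \<in> kth C ` {1..k}"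
    then obtain l where l: "1 \<le> l" "l \<le> k" "c = kth C l" by auto
    then have "c \<le> kth C k"
      using kth_less_kth[OF assms(1), of l k] assms(3) by (cases "l = k") auto
    with l le show "c \<in> {c\<in>C. c \<le> m}" using kth_in[OF assms(1)] assms(3) by auto
  qed
  then have "card (kth C ` {1..k}) \<le> card {c\<in>C. c \<le> m}"
    using assms(1) by (intro card_mono) auto
  moreover have "card (kth C ` {1..k}) = k"
    using inj_on_subset[OF inj_on_kth[OF assms(1)], of "{1..k}"] assms(3) by (simp add: card_image)
  ultimately show "k \<le> card {c\<in>C. c \<le> m}" by simp
next
  assume ge: "k \<le> card {c\<in>C. c \<le> m}"
  show "kth C k \<le> m"
  proof (rule ccontr)
    assume "\<not> kth C k \<le> m"
    have "{c\<in>C. c \<le> m} \<subseteq> kth C ` {1..<k}"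
    proof
      fix c assume c: "c \<in> {c\<in>C. c \<le> m}"
      then have "c \<in> kth C ` {1..card C}" using kth_image[OF assms(1)] by blast
      then obtain l where l: "l \<in> {1..card C}" "c = kth C l" by blast
      have "\<not> k \<le> l"
      proof
        assume "k \<le> l"
        then have "kth C k \<le> kth C l"
          using kth_less_kth[OF assms(1,2), of l] l by (cases "k = l") auto
        then show False using c l \<open>\<not> kth C k \<le> m\<close> by auto
      qed
      with l show "c \<in> kth C ` {1..<k}" by auto
    qed
    then have "card {c\<in>C. c \<le> m} \<le> card (kth C ` {1..<k})" by (intro card_mono) auto
    also have "\<dots> \<le> k - 1" using card_image_le[of "{1..<k}" "kth C"] by simp
    finally show False using ge assms(2) by simp
  qed
qed

lemma kth_mono:
  assumes "finite A" "1 \<le> k" "k \<le> l" "l \<le> card A"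
  shows "kth A k \<le> kth A l"
  using assms kth_less_kth[of A k l] by (cases "k = l") auto

lemma kth_add_le:
  assumes "finite A" "1 \<le> k" "k + t \<le> card A"
  shows "kth A k + t \<le> kth A (k + t)"
  using assms(3)
proof (induction t)
  case (Suc t)
  then show ?case using kth_less_kth[OF assms(1), of "k + t" "k + Suc t"] assms(2) by simp
qed simp

lemma kth_ge:
  assumes "finite A" "0 \<notin> A" "1 \<le> k" "k \<le> card A"
  shows "k \<le> kth A k"
proof -
  have "kth A 1 \<in> A" using kth_in[of A 1] assms by simp
  then have "1 \<le> kth A 1" using assms(2) by (cases "kth A 1") auto
  then show ?thesis using kth_add_le[of A 1 "k - 1"] assms by simp
qed

text \<open>Interlacing: each element removed from \<open>C\<close> shifts positions by at most
  one.\<close>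

lemma kth_subset:
  assumes "finite C" "E \<subseteq> C" "1 \<le> k" "k \<le> card E"
  shows "kth C k \<le> kth E k" and "kth E k \<le> kth C (k + card C - card E)"
proof -
  have fE: "finite E" and EC: "card E \<le> card C"
    using assms(1,2) by (auto intro: finite_subset card_mono)
  have "k \<le> card {c\<in>E. c \<le> kth E k}" using kth_le_iff[OF fE assms(3,4)] by blast
  also have "\<dots> \<le> card {c\<in>C. c \<le> kth E k}" using assms(1,2) by (intro card_mono) auto
  finally show "kth C k \<le> kth E k" using kth_le_iff[of C k] assms EC by auto
  let ?l = "k + card C - card E"
  let ?m = "kth C ?l"
  have "?l \<le> card {c\<in>C. c \<le> ?m}" using kth_le_iff[of C ?l ?m] assms EC by auto
  \<comment> \<open>At most \<open>card C - card E\<close> of the elements of \<open>C\<close> up to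
    \<open>?m\<close> are missing from \<open>E\<close>.\<close>
  also have "\<dots> \<le> card ({c\<in>E. c \<le> ?m} \<union> (C - E))" using assms(1) fE by (intro card_mono) auto
  also have "\<dots> \<le> card {c\<in>E. c \<le> ?m} + (card C - card E)"
    using card_Un_le[of "{c\<in>E. c \<le> ?m}" "C - E"] card_Diff_subset[OF fE assms(2)] by simp
  finally show "kth E k \<le> ?m" using kth_le_iff[OF fE assms(3,4)] EC by auto
qed


section \<open>The maximum over the truncated permutahedron\<close>

text \<open>Position \<open>k + card B - r\<close> in \<open>B\<close> is position \<open>k\<close>
  among the \<open>r\<close> largest elements of \<open>B\<close>. Adding before subtracting keeps
  the natural number difference exact.\<close>

definition fits :: "nat set \<Rightarrow> nat set \<Rightarrow> nat \<Rightarrow> bool"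
  where "fits A B r \<longleftrightarrow> r \<le> card A \<and> r \<le> card B \<and> (\<forall>k\<in>{1..r}. kth A k \<le> kth B (k + card B - r))"

lemma fits_mono:
  assumes "fits A B r" "r' \<le> r" "finite B"
  shows "fits A B r'"
  unfolding fits_def
proof (intro conjI ballI)
  fix k assume k: "k \<in> {1..r'}"
  then have "kth A k \<le> kth B (k + card B - r)" using assms by (auto simp: fits_def)
  also have "\<dots> \<le> kth B (k + card B - r')"
    using assms k by (intro kth_mono) (auto simp: fits_def)
  finally show "kth A k \<le> kth B (k + card B - r')" .
qed (use assms in \<open>auto simp: fits_def\<close>)

text \<open>Interlacing is used twice: \<open>A \<inter> C\<close> inside \<open>A\<close> bounds
  its elements from below, and \<open>A \<inter> C\<close> inside \<open>C\<close> bounds them from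
  above by the largest elements of \<open>C\<close>, hence of \<open>B\<close>.\<close>

lemma fits_card_Int:
  assumes "finite A" "finite C" "card C = card B" "\<forall>k\<in>{1..card B}. kth C k \<le> kth B k"
  shows "fits A B (card (A \<inter> C))"
  unfolding fits_def
proof (intro conjI ballI)
  let ?r = "card (A \<inter> C)"
  show le: "?r \<le> card A" "?r \<le> card B"
    using card_mono[OF assms(1), of "A \<inter> C"] card_mono[OF assms(2), of "A \<inter> C"] assms(3) by auto
  fix k assume k: "k \<in> {1..?r}"
  have "kth A k \<le> kth (A \<inter> C) k" using k assms(1) by (intro kth_subset) auto
  also have "\<dots> \<le> kth C (k + card C - ?r)" using k assms(2) by (intro kth_subset) auto
  also have "\<dots> \<le> kth B (k + card B - ?r)"
  proof -
    have "k + card B - ?r \<in> {1..card B}" using k le by auto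
    with assms(3,4) show ?thesis by simp
  qed
  finally show "kth A k \<le> kth B (k + card B - ?r)" .
qed

text \<open>The witness takes the \<open>r\<close> smallest elements of \<open>A\<close> and fills
  up with an initial segment of the integers, the smallest elements available.\<close>

lemma fits_realised:
  assumes fits: "fits A B r" and A: "A \<subseteq> {1..n}" and B: "B \<subseteq> {1..n}"
  obtains C where "C \<subseteq> {1..n}" "card C = card B" "\<forall>k\<in>{1..card B}. kth C k \<le> kth B k"
    "r \<le> card (A \<inter> C)"
proof -
  have fin: "finite A" "finite B" using A B finite_subset by auto
  define E where "E = kth A ` {1..r}"
  have rA: "r \<le> card A" and rB: "r \<le> card B" using fits by (auto simp: fits_def)
  have EA: "E \<subseteq> A" using kth_in[OF fin(1)] rA by (auto simp: E_def)
  have cE: "card E = r"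
    using inj_on_subset[OF inj_on_kth[OF fin(1)], of "{1..r}"] rA by (simp add: E_def card_image)
  have fE: "finite E" by (simp add: E_def)
  have cBn: "card B \<le> n" using card_mono[OF _ B] by simp
  \<comment> \<open>Raising \<open>q\<close> by one adds at most one element, so the least
    \<open>q\<close> that reaches \<open>card B\<close> hits it exactly; for \<open>q = 0\<close>
    the bound \<open>r \<le> card B\<close> does this.\<close>
  define q where "q = (LEAST q. card B \<le> card (E \<union> {1..q}))"
  have "card B \<le> card (E \<union> {1..card B})"
    using card_mono[of "E \<union> {1..card B}" "{1..card B}"] fE by simp
  then have qB: "q \<le> card B" and q1: "card B \<le> card (E \<union> {1..q})"
    unfolding q_def by (auto intro: Least_le LeastI)
  have q2: "card (E \<union> {1..q}) \<le> card B"
  proof (cases q)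
    case 0
    then show ?thesis using cE rB by simp
  next
    case (Suc p)
    then have "\<not> card B \<le> card (E \<union> {1..p})" unfolding q_def by (metis lessI not_less_Least)
    moreover have "E \<union> {1..q} = insert q (E \<union> {1..p})" using Suc by auto
    ultimately show ?thesis using card_insert_le_m1 fE by (simp add: card_insert_if)
  qed
  define C where "C = E \<union> {1..q}"
  have cC: "card C = card B" using q1 q2 by (simp add: C_def)
  have fC: "finite C" using fE by (simp add: C_def)
  have "kth C k \<le> kth B k" if k: "k \<in> {1..card B}" for k
  proof -
    let ?m = "kth B k"
    have "k \<le> card {c\<in>C. c \<le> ?m}"
    proof (cases "?m \<le> q")
      case True
      have "0 \<notin> B" using B by auto
      then have "k \<le> card {1..?m}" using kth_ge[OF fin(2), of k] k by auto
      also have "\<dots> \<le> card {c\<in>C. c \<le> ?m}"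
        using True fC by (intro card_mono) (auto simp: C_def)
      finally show ?thesis .
    next
      case False
      \<comment> \<open>Elements of \<open>C\<close> above \<open>?m\<close> exceed
        \<open>q\<close>, so they come from \<open>E\<close>, and \<open>fits\<close> forces their
        index in \<open>A\<close> to be large. If \<open>k + r - card B\<close> truncates to 0, the
        resulting bound \<open>r\<close> is still at most \<open>card B - k\<close>.\<close>
      have "{c\<in>C. \<not> c \<le> ?m} \<subseteq> kth A ` {k + r - card B<..r}"
      proof
        fix c assume c: "c \<in> {c\<in>C. \<not> c \<le> ?m}"
        then have "c \<in> E" using False by (auto simp: C_def)
        then obtain l where l: "l \<in> {1..r}" "c = kth A l" by (auto simp: E_def)
        have "k + r - card B < l"
        proof (rule ccontr)
          assume "\<not> k + r - card B < l"
          then have "kth B (l + card B - r) \<le> ?m"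
            using l k rB by (intro kth_mono fin(2)) auto
          moreover have "c \<le> kth B (l + card B - r)" using fits l by (auto simp: fits_def)
          ultimately show False using c by simp
        qed
        with l show "c \<in> kth A ` {k + r - card B<..r}" by auto
      qed
      then have "card {c\<in>C. \<not> c \<le> ?m} \<le> card (kth A ` {k + r - card B<..r})"
        by (intro card_mono) auto
      also have "\<dots> \<le> card {k + r - card B<..r}" by (intro card_image_le) simp
      also have "\<dots> \<le> card B - k" by auto
      finally have 1: "card {c\<in>C. \<not> c \<le> ?m} \<le> card B - k" .
      have "card C \<le> card {c\<in>C. c \<le> ?m} + card {c\<in>C. \<not> c \<le> ?m}"
        using card_Un_le[of "{c\<in>C. c \<le> ?m}" "{c\<in>C. \<not> c \<le> ?m}"]
        by (simp add: Collect_disj_eq[symmetric] conj_disj_distribL[symmetric])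
      then show ?thesis using 1 k cC by auto
    qed
    then show ?thesis using kth_le_iff[OF fC] k cC by auto
  qed
  moreover have "C \<subseteq> {1..n}" using EA A qB cBn by (auto simp: C_def)
  moreover have "r \<le> card (A \<inter> C)"
    using card_mono[of "A \<inter> C" E] EA fin(1) cE by (auto simp: C_def)
  ultimately show thesis using that cC by blast
qed

lemma inner_n_indicator_diff:
  assumes "C \<subseteq> {1..n}" "D \<subseteq> {1..n}"
  shows "inner_n n (indicator A) (indicator C - indicator D)
    = real (card (A \<inter> C)) - real (card (A \<inter> D))"
proof -
  have *: "(\<Sum>m=1..n. indicator A m * indicator C m :: real) = real (card (A \<inter> C))"
    if "C \<subseteq> {1..n}" for C
  proof -
    have "(\<Sum>m=1..n. indicator A m * indicator C m :: real) = (\<Sum>m=1..n. indicator (A \<inter> C) m)"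
      by (simp add: indicator_inter_arith)
    also have "\<dots> = real (card (A \<inter> C))"
      using that by (auto simp: indicator_def sum.If_cases intro!: arg_cong[of _ _ card])
    finally show ?thesis .
  qed
  show ?thesis
    using *[OF assms(1)] *[OF assms(2)]
    by (simp add: inner_n_def right_diff_distrib sum_subtractf)
qed

lemma convex_inner_n_le: "convex {x. inner_n n a x \<le> m}"
proof -
  have "linear (inner_n n a)"
    by (rule linearI)
      (simp_all add: inner_n_def scaleR_fun_def algebra_simps sum.distrib sum_distrib_left)
  then have "convex (inner_n n a -` {..m})" by (intro convex_linear_vimage) simp_all
  then show ?thesis by (simp add: vimage_def)
qed

lemma is_maximum_on_trunc_perm:
  assumes A: "A \<subseteq> {1..n}" and B: "B \<subseteq> {1..n}"
    and R: "fits A B R" "\<And>r. fits A B r \<Longrightarrow> r \<le> R"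
  shows "is_maximum_on (inner_n n (indicator A)) (trunc_perm n B)
    (real R - real (card (A \<inter> {1..card B})))"
proof -
  let ?j = "{1..card B}"
  let ?S = "{indicator C - indicator ?j | C. C \<subseteq> {1..n} \<and> card C = card B
    \<and> (\<forall>k\<in>?j. kth C k \<le> kth B k)} :: (nat \<Rightarrow> real) set"
  have jn: "?j \<subseteq> {1..n}" using card_mono[OF _ B] by auto
  have fA: "finite A" using A finite_subset by auto
  have le: "card (A \<inter> C) \<le> R"
    if "C \<subseteq> {1..n}" "card C = card B" "\<forall>k\<in>?j. kth C k \<le> kth B k" for C
    using R(2) fits_card_Int[OF fA _ that(2,3)] finite_subset[OF that(1)] by auto
  obtain C where C: "C \<subseteq> {1..n}" "card C = card B" "\<forall>k\<in>?j. kth C k \<le> kth B k"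
    "R \<le> card (A \<inter> C)" using fits_realised[OF R(1) A B] .
  have "indicator C - indicator ?j \<in> trunc_perm n B"
    unfolding trunc_perm_def using C by (intro hull_inc) auto
  moreover have "inner_n n (indicator A) (indicator C - indicator ?j) = real R - real (card (A \<inter> ?j))"
    using inner_n_indicator_diff[OF C(1) jn] le[OF C(1-3)] C(4) by simp
  \<comment> \<open>A convex half-space contains the hull once it contains the generators.\<close>
  moreover have "trunc_perm n B
    \<subseteq> {x. inner_n n (indicator A) x \<le> real R - real (card (A \<inter> ?j))}"
    unfolding trunc_perm_def
  proof (rule hull_minimal)
    show "convex {x. inner_n n (indicator A) x \<le> real R - real (card (A \<inter> ?j))}"
      by (rule convex_inner_n_le)
    show "?S \<subseteq> {x. inner_n n (indicator A) x \<le> real R - real (card (A \<inter> ?j))}"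
    proof
      fix x assume "x \<in> ?S"
      then obtain C where "C \<subseteq> {1..n}" "card C = card B" "\<forall>k\<in>?j. kth C k \<le> kth B k"
        and x: "x = indicator C - indicator ?j" by blast
      then show "x \<in> {x. inner_n n (indicator A) x \<le> real R - real (card (A \<inter> ?j))}"
        using inner_n_indicator_diff[OF _ jn] le by simp
    qed
  qed
  ultimately show ?thesis unfolding is_maximum_on_def by blast
qed


section \<open>Homomorphisms between Maya modules\<close>

text \<open>Duality makes the vectors \<open>e r\<close> independent. They span because
  \<open>x\<close> minus its expansion with coefficients \<open>\<gamma> r x\<close> is killed by
  every functional, and the functionals separate the points of \<open>S\<close>.\<close>

lemma (in vector_space) dim_eq_card_dual_basis:
  fixes \<gamma> :: "'i \<Rightarrow> 'b \<Rightarrow> 'a"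
  assumes S: "subspace S" and D: "finite D"
    and e: "\<And>r. r \<in> D \<Longrightarrow> e r \<in> S"
    and add: "\<And>r x y. \<gamma> r (x + y) = \<gamma> r x + \<gamma> r y"
    and scale: "\<And>r c x. \<gamma> r (c *s x) = c * \<gamma> r x"
    and delta: "\<And>r s. r \<in> D \<Longrightarrow> s \<in> D \<Longrightarrow> \<gamma> r (e s) = (if r = s then 1 else 0)"
    and sep: "\<And>x. x \<in> S \<Longrightarrow> (\<And>r. r \<in> D \<Longrightarrow> \<gamma> r x = 0) \<Longrightarrow> x = 0"
  shows "dim S = card D"
proof -
  have zero: "\<gamma> r 0 = 0" for r using scale[of r 0 0] by simp
  have sum: "\<gamma> r (\<Sum>s\<in>F. c s *s e s) = (\<Sum>s\<in>F. c s * \<gamma> r (e s))" if "finite F" for r c F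
    using that by (induction F) (simp_all add: zero add scale)
  have coeff: "\<gamma> r (\<Sum>s\<in>D. c s *s e s) = c r" if r: "r \<in> D" for r c
  proof -
    have "\<gamma> r (\<Sum>s\<in>D. c s *s e s) = (\<Sum>s\<in>D. if r = s then c s else 0)"
      unfolding sum[OF D] using r by (intro sum.cong) (auto simp: delta)
    then show ?thesis using r D by simp
  qed
  have inj: "inj_on e D"
  proof (rule inj_onI)
    fix r s assume "r \<in> D" "s \<in> D" "e r = e s"
    then show "r = s" using delta[of r r] delta[of r s] by (auto split: if_splits)
  qed
  have "independent (e ` D)"
  proof (rule independent_if_scalars_zero)
    fix f x assume f: "(\<Sum>x\<in>e ` D. f x *s x) = 0" and "x \<in> e ` D"
    then obtain r where r: "r \<in> D" "x = e r" by auto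
    have "(\<Sum>s\<in>D. f (e s) *s e s) = 0" using f by (simp add: sum.reindex[OF inj])
    then show "f x = 0" using coeff[OF r(1), of "\<lambda>s. f (e s)"] r zero by simp
  qed (use D in simp)
  moreover have "S \<subseteq> span (e ` D)"
  proof
    fix x assume x: "x \<in> S"
    let ?y = "\<Sum>s\<in>D. \<gamma> s x *s e s"
    have "?y \<in> S" using S e by (intro subspace_sum subspace_scale) auto
    then have "x + (-1) *s ?y \<in> S" using S x by (intro subspace_add subspace_scale)
    then have "x + (-1) *s ?y = 0" by (rule sep) (simp only: add scale coeff, simp)
    then have "x = ?y" by simp
    also have "\<dots> \<in> span (e ` D)" by (intro span_sum span_scale span_base) auto
    finally show "x \<in> span (e ` D)" .
  qed
  ultimately have "dim S = card (e ` D)" using e by (intro dim_unique) auto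
  then show ?thesis using card_image[OF inj] by simp
qed

section \<open>Coordinates and structure maps of Maya modules\<close>

lemma maya_index_iff: "(q, k) \<in> maya_index A \<longleftrightarrow> 1 \<le> k \<and> k \<le> card A \<and> k \<le> q \<and> q < kth A k"
  by (auto simp: maya_index_def)

lemma finite_maya_row: "finite {k. (q, k) \<in> maya_index A}"
  by (rule finite_subset[of _ "{..card A}"]) (auto simp: maya_index_def)

lemma maya_index_bounds:
  assumes "A \<subseteq> {1..n}" "(q, k) \<in> maya_index A"
  shows "1 \<le> q" "q + 1 \<le> n"
proof -
  have "finite A" using assms(1) finite_subset by auto
  then have "kth A k \<in> A" using assms(2) kth_in by (simp add: maya_index_iff)
  then show "1 \<le> q" "q + 1 \<le> n" using assms by (auto simp: maya_index_iff)
qed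

text \<open>Since \<open>kth\<close> grows strictly, each row of the index set ends at least one
  grade later than the row before.\<close>

lemma maya_index_diag:
  assumes "finite A" "(q, k) \<in> maya_index A" "k + t \<le> card A"
  shows "(q + t, k + t) \<in> maya_index A"
  using assms kth_add_le[of A k t] by (auto simp: maya_index_iff)

lemma smul_maya: "smul (maya_module A) = maya_smul"
  by (simp add: maya_module_def)

lemma grade_maya:
  "grade (maya_module A) q = {x. \<forall>p. x p \<noteq> 0 \<longrightarrow> p \<in> maya_index A \<and> fst p = q}"
  by (simp add: maya_module_def)

lemma grade_maya_zero:
  "x \<in> grade (maya_module A) q \<Longrightarrow> (q', k) \<notin> maya_index A \<or> q' \<noteq> q \<Longrightarrow> x (q', k) = 0"
  unfolding grade_maya by auto

lemma subspace_grade_maya: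
  "module.subspace (maya_smul :: 'k::field \<Rightarrow> _) (grade (maya_module A) q)"
proof -
  interpret V: vector_space "maya_smul :: 'k \<Rightarrow> _" by (rule vector_space_maya_smul)
  show ?thesis
    unfolding V.subspace_def grade_maya by (auto simp: maya_smul_def) (metis add.right_neutral)+
qed

lemma maya_vec_in_grade: "maya_vec A q k \<in> grade (maya_module A) q"
  by (auto simp: grade_maya maya_vec_def split: if_splits)

lemma maya_vec_expand:
  assumes "x \<in> grade (maya_module A) q"
  shows "x = (\<Sum>k\<in>{k. (q, k) \<in> maya_index A}. maya_smul (x (q, k)) (maya_vec A q k))"
proof
  fix p :: "nat \<times> nat"
  obtain q' k' where p: "p = (q', k')" by (cases p)
  have "(\<Sum>k\<in>K. maya_smul (x (q, k)) (maya_vec A q k)) p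
      = (\<Sum>k\<in>K. x (q, k) * maya_vec A q k p)" if "finite K" for K
    using that by induction (simp_all add: maya_smul_def)
  from this[OF finite_maya_row[of q A]]
  have "(\<Sum>k\<in>{k. (q, k) \<in> maya_index A}. maya_smul (x (q, k)) (maya_vec A q k)) p
      = (\<Sum>k\<in>{k. (q, k) \<in> maya_index A}. x (q, k) * maya_vec A q k p)" .
  also have "\<dots> = (\<Sum>k\<in>{k. (q, k) \<in> maya_index A}. if k = k' then x p else 0)"
    using assms by (intro sum.cong) (auto simp: maya_vec_def p grade_maya)
  also have "\<dots> = x p" using assms finite_maya_row[of q A] by (auto simp: p grade_maya)
  finally show "x p = (\<Sum>k\<in>{k. (q, k) \<in> maya_index A}. maya_smul (x (q, k)) (maya_vec A q k)) p"
    by simp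
qed

text \<open>Only the target index is tested: a graded \<open>x\<close> already vanishes at
  \<open>(q, k' - 1)\<close> off the index set, in particular for \<open>k' = 1\<close>.\<close>

lemma up_maya:
  assumes x: "x \<in> grade (maya_module A) q"
  shows "up (maya_module A) q x (q', k')
    = (if q' = q + 1 \<and> (q', k') \<in> maya_index A then x (q, k' - 1) else 0)"
proof -
  let ?u = "if q' = q + 1 \<and> (q', k') \<in> maya_index A then x (q, k' - 1) else 0"
  have "(\<Sum>k\<in>K. maya_smul (x (q, k)) (maya_vec A (q+1) (k+1))) (q', k')
      = (\<Sum>k\<in>K. x (q, k) * maya_vec A (q+1) (k+1) (q', k'))" if "finite K" for K
    using that by induction (simp_all add: maya_smul_def)
  from this[OF finite_maya_row[of q A]]
  have "up (maya_module A) q x (q', k')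
      = (\<Sum>k\<in>{k. (q, k) \<in> maya_index A}. x (q, k) * maya_vec A (q+1) (k+1) (q', k'))"
    by (simp add: maya_module_def)
  also have "\<dots> = (\<Sum>k\<in>{k. (q, k) \<in> maya_index A}. if k = k' - 1 then ?u else 0)"
    by (rule sum.cong) (auto simp: maya_vec_def maya_index_iff)
  also have "\<dots> = ?u" using finite_maya_row[of q A] grade_maya_zero[OF x, of q "k' - 1"] by auto
  finally show ?thesis .
qed

lemma down_maya:
  assumes x: "x \<in> grade (maya_module A) q"
  shows "down (maya_module A) q x (q', k')
    = (if q' = q - 1 \<and> (q', k') \<in> maya_index A then x (q, k') else 0)"
proof -
  let ?u = "if q' = q - 1 \<and> (q', k') \<in> maya_index A then x (q, k') else 0"
  have "(\<Sum>k\<in>K. maya_smul (x (q, k)) (maya_vec A (q-1) k)) (q', k')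
      = (\<Sum>k\<in>K. x (q, k) * maya_vec A (q-1) k (q', k'))" if "finite K" for K
    using that by induction (simp_all add: maya_smul_def)
  from this[OF finite_maya_row[of q A]]
  have "down (maya_module A) q x (q', k')
      = (\<Sum>k\<in>{k. (q, k) \<in> maya_index A}. x (q, k) * maya_vec A (q-1) k (q', k'))"
    by (simp add: maya_module_def)
  also have "\<dots> = (\<Sum>k\<in>{k. (q, k) \<in> maya_index A}. if k = k' then ?u else 0)"
    by (rule sum.cong) (auto simp: maya_vec_def)
  also have "\<dots> = ?u" using finite_maya_row[of q A] grade_maya_zero[OF x, of q k'] by auto
  finally show ?thesis .
qed

lemma up_maya_in_grade:
  assumes "x \<in> grade (maya_module A) q"
  shows "up (maya_module A) q x \<in> grade (maya_module A) (q + 1)"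
  unfolding grade_maya[of A "q + 1"] by (auto simp: up_maya[OF assms] split: if_splits)

lemma down_maya_in_grade:
  assumes "x \<in> grade (maya_module A) q"
  shows "down (maya_module A) q x \<in> grade (maya_module A) (q - 1)"
  unfolding grade_maya[of A "q - 1"] by (auto simp: down_maya[OF assms] split: if_splits)

lemma up_maya_vec:
  "(q, k) \<in> maya_index A \<Longrightarrow> up (maya_module A) q (maya_vec A q k) = maya_vec A (q + 1) (k + 1)"
  unfolding fun_eq_iff split_paired_All
  by (auto simp: up_maya[OF maya_vec_in_grade]) (auto simp: maya_vec_def maya_index_iff)

lemma down_maya_vec:
  "(q, k) \<in> maya_index A \<Longrightarrow> down (maya_module A) q (maya_vec A q k) = maya_vec A (q - 1) k"
  unfolding fun_eq_iff split_paired_All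
  by (auto simp: down_maya[OF maya_vec_in_grade]) (auto simp: maya_vec_def maya_index_iff)

section \<open>Matrix coefficients of a homomorphism\<close>

context
  fixes n :: nat and A B :: "nat set" and f :: "nat \<Rightarrow> (nat \<times> nat \<Rightarrow> 'k::field) \<Rightarrow> (nat \<times> nat \<Rightarrow> 'k)"
  assumes A: "A \<subseteq> {1..n}" and B: "B \<subseteq> {1..n}"
    and f: "f \<in> Hom_Lambda n (maya_module A) (maya_module B)"
begin

definition hom_coeff :: "nat \<Rightarrow> nat \<Rightarrow> nat \<Rightarrow> 'k"
  where "hom_coeff q k l = f q (maya_vec A q k) (q, l)"

lemma hom_in_grade:
  assumes "x \<in> grade (maya_module A) q"
  shows "f q x \<in> grade (maya_module B) q"
proof (cases "q \<in> {1..n-1}")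
  case True
  then show ?thesis using f assms unfolding Hom_Lambda_def linear_on_def by blast
next
  case False
  then have "f q x = 0" using f unfolding Hom_Lambda_def by blast
  then show ?thesis by (simp add: grade_maya)
qed

text \<open>A nonzero coefficient certifies that both of its positions are indices. The transport
  arguments below draw their side conditions from this.\<close>

lemma hom_coeff_nonzero:
  assumes "hom_coeff q k l \<noteq> 0"
  shows "(q, k) \<in> maya_index A" "(q, l) \<in> maya_index B"
proof -
  show B': "(q, l) \<in> maya_index B"
    using assms grade_maya_zero[OF hom_in_grade[OF maya_vec_in_grade]] unfolding hom_coeff_def by blast
  show "(q, k) \<in> maya_index A"
  proof (rule ccontr)
    assume "(q, k) \<notin> maya_index A"
    then have w: "maya_vec A q k = (0 :: _ \<Rightarrow> 'k)" by (auto simp: maya_vec_def fun_eq_iff)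
    have "q \<in> {1..n-1}" using maya_index_bounds[OF B B'] by auto
    then have "linear_on maya_smul maya_smul (grade (maya_module A) q) (grade (maya_module B) q) (f q)"
      using f unfolding Hom_Lambda_def smul_maya by blast
    moreover have "(0 :: _ \<Rightarrow> 'k) \<in> grade (maya_module A) q" by (simp add: grade_maya)
    ultimately have "f q (maya_smul 0 0) = maya_smul 0 (f q 0)" unfolding linear_on_def by blast
    moreover have "maya_smul 0 y = 0" for y :: "_ \<Rightarrow> 'k" by (simp add: maya_smul_def fun_eq_iff)
    ultimately have "f q 0 = 0" by metis
    then have "hom_coeff q k l = 0" unfolding hom_coeff_def w by (metis zero_fun_def)
    with assms show False by contradiction
  qed
qed

text \<open>Compares one coordinate in the commutation with \<open>up\<close>. The vector
  \<open>maya_vec A (q + 1) (k + 1)\<close> may be 0, and \<open>(q, l)\<close> may lie outside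
  \<open>maya_index B\<close>; the equation then forces the other coefficient to vanish.\<close>

lemma hom_coeff_up:
  assumes "(q, k) \<in> maya_index A" "(q + 1, l + 1) \<in> maya_index B"
  shows "hom_coeff (q + 1) (k + 1) (l + 1) = hom_coeff q k l"
proof -
  have "1 \<le> q \<and> q + 2 \<le> n"
    using maya_index_bounds[OF A assms(1)] maya_index_bounds[OF B assms(2)] by simp
  then have "f (q + 1) (up (maya_module A) q (maya_vec A q k))
    = up (maya_module B) q (f q (maya_vec A q k))"
    using f maya_vec_in_grade unfolding Hom_Lambda_def by blast
  then show ?thesis
    using assms by (simp add: hom_coeff_def up_maya_vec up_maya[OF hom_in_grade[OF maya_vec_in_grade]])
qed

lemma hom_coeff_down:
  assumes "(q + 1, k) \<in> maya_index A" "(q, l) \<in> maya_index B"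
  shows "hom_coeff q k l = hom_coeff (q + 1) k l"
proof -
  have "2 \<le> q + 1 \<and> q + 1 + 1 \<le> n"
    using maya_index_bounds[OF A assms(1)] maya_index_bounds[OF B assms(2)] by simp
  then have "f (q + 1 - 1) (down (maya_module A) (q + 1) (maya_vec A (q + 1) k))
    = down (maya_module B) (q + 1) (f (q + 1) (maya_vec A (q + 1) k))"
    using f maya_vec_in_grade unfolding Hom_Lambda_def by blast
  then have "f q (maya_vec A q k)
    = down (maya_module B) (q + 1) (f (q + 1) (maya_vec A (q + 1) k))"
    by (simp only: down_maya_vec[OF assms(1)] add_diff_cancel_right')
  then show ?thesis
    using assms by (simp add: hom_coeff_def down_maya[OF hom_in_grade[OF maya_vec_in_grade]])
qed

text \<open>A nonzero coefficient is moved along the path in \<open>N(B)\<close> that leads to the socle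
  \<open>w\<^bsub>j,j\<^esub>\<close>.\<close>

lemma hom_coeff_socle:
  assumes "hom_coeff q k l \<noteq> 0"
  shows "hom_coeff (card B) (k + (card B - l)) (card B) \<noteq> 0"
proof -
  have fB: "finite B" using B finite_subset by auto
  \<comment> \<open>First leg: descend along row \<open>l\<close> of \<open>N(B)\<close> to its left
    end, in grade \<open>l\<close>.\<close>
  have 1: "hom_coeff (l + t) k l \<noteq> 0 \<Longrightarrow> hom_coeff l k l \<noteq> 0" for t
  proof (induction t)
    case (Suc t)
    from hom_coeff_nonzero[OF Suc.prems]
    have "(l + t + 1, k) \<in> maya_index A" "(l + t, l) \<in> maya_index B"
      by (auto simp: maya_index_iff)
    from hom_coeff_down[OF this] Suc show ?case by simp
  qed simp
  have l: "l \<le> q" "l \<le> card B" using hom_coeff_nonzero(2)[OF assms] by (auto simp: maya_index_iff)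
  \<comment> \<open>Second leg: climb the diagonal to the socle. Nonvanishing at each stage supplies
    the index in \<open>A\<close> needed for the next.\<close>
  have 2: "hom_coeff (l + t) (k + t) (l + t) \<noteq> 0" if "l + t \<le> card B" for t
    using that
  proof (induction t)
    case 0
    then show ?case using 1[of "q - l"] assms l by simp
  next
    case (Suc t)
    then have nz: "hom_coeff (l + t) (k + t) (l + t) \<noteq> 0" by simp
    from hom_coeff_nonzero[OF this] maya_index_diag[OF fB, of "l + t" "l + t" 1] Suc.prems
    have "(l + t, k + t) \<in> maya_index A" "(l + t + 1, l + t + 1) \<in> maya_index B" by auto
    from hom_coeff_up[OF this] nz show ?case by simp
  qed
  from 2[of "card B - l"] l show ?thesis by simp
qed

text \<open>If the inequality failed at some \<open>k\<close>, the nonzero coefficient could be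
  carried backwards along arrows to a position where \<open>N(B)\<close> has no basis
  vector.\<close>

lemma fits_hom_coeff:
  assumes nz: "hom_coeff (card B) r (card B) \<noteq> 0"
  shows "fits A B r"
  unfolding fits_def
proof (intro conjI ballI)
  let ?j = "card B"
  have fin: "finite A" "finite B" using A B finite_subset by auto
  show r: "r \<le> card A" "r \<le> ?j"
    using hom_coeff_nonzero[OF nz] by (auto simp: maya_index_iff)
  \<comment> \<open>Backwards along the down arrows of row \<open>r\<close> of \<open>N(A)\<close>;
    the matching index in \<open>B\<close> is a consequence of nonvanishing.\<close>
  have 1: "hom_coeff (?j + t) r ?j \<noteq> 0" if "(?j + t, r) \<in> maya_index A" for t
    using that
  proof (induction t)
    case (Suc t)
    then have "(?j + t, r) \<in> maya_index A" using r(2) by (auto simp: maya_index_iff)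
    then have nz': "hom_coeff (?j + t) r ?j \<noteq> 0" using Suc.IH by simp
    have "hom_coeff (?j + t) r ?j = hom_coeff (?j + t + 1) r ?j"
      using Suc.prems hom_coeff_nonzero(2)[OF nz'] by (intro hom_coeff_down) auto
    then show ?case using nz' by simp
  qed (simp add: nz)
  fix k assume k: "k \<in> {1..r}"
  \<comment> \<open>The first grade beyond the right end of row \<open>k + ?j - r\<close> of
    \<open>N(B)\<close>.\<close>
  let ?q = "kth B (k + ?j - r)"
  show "kth A k \<le> ?q"
  proof (rule ccontr)
    assume less: "\<not> kth A k \<le> ?q"
    have "0 \<notin> B" using B by auto
    then have q: "k + ?j - r \<le> ?q" using kth_ge[OF fin(2), of "k + ?j - r"] k r by auto
    then have qA: "(?q, k) \<in> maya_index A" using less k r by (auto simp: maya_index_iff)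
    then have "(?q + (r - k), r) \<in> maya_index A"
      using maya_index_diag[OF fin(1), of ?q k "r - k"] k r by auto
    then have nz1: "hom_coeff (?q + (r - k)) r ?j \<noteq> 0"
      using 1[of "?q + (r - k) - ?j"] q k r by simp
    \<comment> \<open>Backwards along the up arrows, from \<open>t = r - k\<close> to
      \<open>t = 0\<close>, where the target index lies outside \<open>maya_index B\<close>.\<close>
    have "hom_coeff (?q + t) (k + t) (k + ?j - r + t) \<noteq> 0" if "t \<le> r - k" for t
      using that
    proof (induction rule: inc_induct)
      case base
      then show ?case using nz1 k r by simp
    next
      case (step t)
      have "(?q + t, k + t) \<in> maya_index A"
        using maya_index_diag[OF fin(1) qA, of t] step.hyps r k by auto
      then show ?case
        using hom_coeff_up[of "?q + t" "k + t" "k + ?j - r + t"] hom_coeff_nonzero[OF step.IH]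
          step.IH by simp
    qed
    from hom_coeff_nonzero(2)[OF this[of 0]] show False by (simp add: maya_index_iff)
  qed
qed

text \<open>Any nonzero coefficient would yield a nonzero one at the socle, whose source index
  satisfies \<open>fits\<close>. Hence the listed functionals separate homomorphisms.\<close>

lemma hom_eq_zero:
  assumes "\<And>r. (card B, r) \<in> maya_index A \<Longrightarrow> fits A B r \<Longrightarrow> hom_coeff (card B) r (card B) = 0"
  shows "f = 0"
proof -
  have zero: "hom_coeff q k l = 0" for q k l
    using hom_coeff_socle fits_hom_coeff hom_coeff_nonzero(1) assms by blast
  have "f q x = 0" for q x
  proof (cases "q \<in> {1..n-1} \<and> x \<in> grade (maya_module A) q")
    case True
    then have "linear_on maya_smul maya_smul (grade (maya_module A) q) (grade (maya_module B) q) (f q)"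
      using f unfolding Hom_Lambda_def smul_maya by blast
    then have add: "f q (x + y) = f q x + f q y"
      and scale: "f q (maya_smul c x) = maya_smul c (f q x)"
      if "x \<in> grade (maya_module A) q" "y \<in> grade (maya_module A) q" for x y c
      using that unfolding linear_on_def by blast+
    interpret V: vector_space "maya_smul :: 'k \<Rightarrow> _" by (rule vector_space_maya_smul)
    note sub = subspace_grade_maya[of A q]
    have w: "f q (maya_vec A q k) = 0" for k
    proof -
      have "f q (maya_vec A q k) (q', l) = 0" for q' l
        using zero[of q k l] grade_maya_zero[OF hom_in_grade[OF maya_vec_in_grade[of A q k]], of q' l]
        by (cases "q' = q") (auto simp: hom_coeff_def)
      then show ?thesis by (auto simp: fun_eq_iff)
    qed
    have f0: "f q 0 = 0"
      using scale[OF V.subspace_0[OF sub] V.subspace_0[OF sub], of 0] by simp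
    have "f q (\<Sum>k\<in>K. maya_smul (c k) (maya_vec A q k)) = 0" if "finite K" for K c
      using that
    proof induction
      case (insert k K)
      have "f q (maya_smul (c k) (maya_vec A q k) + (\<Sum>k\<in>K. maya_smul (c k) (maya_vec A q k)))
        = f q (maya_smul (c k) (maya_vec A q k)) + f q (\<Sum>k\<in>K. maya_smul (c k) (maya_vec A q k))"
        by (intro add V.subspace_scale V.subspace_sum sub maya_vec_in_grade)
      also have "f q (maya_smul (c k) (maya_vec A q k)) = 0"
        by (simp only: scale[OF maya_vec_in_grade maya_vec_in_grade] w V.scale_zero_right)
      finally show ?case
        by (simp only: sum.insert[OF insert.hyps] insert.IH add_0_left)
    qed (simp only: sum.empty f0)
    from this[OF finite_maya_row] show ?thesis
      using maya_vec_expand[of x A q] True by metis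
  next
    case False
    then show ?thesis using f unfolding Hom_Lambda_def by blast
  qed
  then show ?thesis by (simp add: fun_eq_iff)
qed

end

section \<open>Shift homomorphisms\<close>

definition shift_hom ::
  "nat \<Rightarrow> nat set \<Rightarrow> nat set \<Rightarrow> nat \<Rightarrow> nat \<Rightarrow> (nat \<times> nat \<Rightarrow> 'k::field) \<Rightarrow> (nat \<times> nat \<Rightarrow> 'k)"
  where "shift_hom n A B d q x = (\<lambda>(q', l).
    if q \<in> {1..n-1} \<and> x \<in> grade (maya_module A) q \<and> q' = q \<and> (q, l) \<in> maya_index B
    then x (q, l - d) else 0)"

text \<open>For \<open>l \<le> d\<close> the truncated \<open>l - d\<close> is 0, and a graded
  \<open>x\<close> has zero coordinate at \<open>(q, 0)\<close>. The grade test matches the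
  convention in \<open>Hom_Lambda\<close> that values off the components are 0.\<close>

lemma shift_hom_apply:
  "shift_hom n A B d q x (q', l) =
    (if q \<in> {1..n-1} \<and> x \<in> grade (maya_module A) q \<and> q' = q \<and> (q, l) \<in> maya_index B
     then x (q, l - d) else 0)"
  by (simp add: shift_hom_def)

text \<open>Commutation could fail only if one route around a square passed through a zero vector
  while the other route gave a nonzero one. The \<open>fits\<close> condition excludes this.\<close>

lemma shift_hom_in_Hom:
  assumes A: "A \<subseteq> {1..n}" and B: "B \<subseteq> {1..n}" and fits: "fits A B r"
  shows "shift_hom n A B (card B - r)
    \<in> Hom_Lambda n (maya_module A) (maya_module B :: ('k::field, _) graded_rep)"
proof -
  let ?M = "maya_module A :: ('k, _) graded_rep"
  let ?d = "card B - r"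
  let ?e = "shift_hom n A B ?d :: nat \<Rightarrow> (nat \<times> nat \<Rightarrow> 'k) \<Rightarrow> _"
  have fin: "finite A" "finite B" using A B finite_subset by auto
  have rA: "r \<le> card A" and rB: "r \<le> card B"
    and ab: "\<And>k. 1 \<le> k \<Longrightarrow> k \<le> r \<Longrightarrow> kth A k \<le> kth B (k + card B - r)"
    using fits by (auto simp: fits_def)
  interpret V: vector_space "maya_smul :: 'k \<Rightarrow> _" by (rule vector_space_maya_smul)
  note sub = subspace_grade_maya[of A, where ?'k = 'k]
  have gr: "?e q x \<in> grade (maya_module B) q" for q x
    unfolding grade_maya[of B] by (simp add: shift_hom_def split: prod.split)
  have lin: "linear_on maya_smul maya_smul (grade ?M q) (grade (maya_module B) q) (?e q)"
    if q: "q \<in> {1..n-1}" for q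
    unfolding linear_on_def
  proof (intro conjI ballI allI)
    show "?e q ` grade ?M q \<subseteq> grade (maya_module B) q" using gr by blast
  next
    fix x y assume "x \<in> grade ?M q" "y \<in> grade ?M q"
    moreover from this have "x + y \<in> grade ?M q" by (rule V.subspace_add[OF sub])
    ultimately show "?e q (x + y) = ?e q x + ?e q y" by (auto simp: shift_hom_def fun_eq_iff)
  next
    fix c x assume "x \<in> grade ?M q"
    moreover from this have "maya_smul c x \<in> grade ?M q" by (rule V.subspace_scale[OF sub])
    ultimately show "?e q (maya_smul c x) = maya_smul c (?e q x)"
      by (auto simp: shift_hom_def maya_smul_def fun_eq_iff)
  qed
  \<comment> \<open>A shifted row of \<open>N(A)\<close> ends no later than the row of
    \<open>N(B)\<close> that it lands in.\<close>
  have row: "q < kth B (k + ?d)" if "(q, k) \<in> maya_index A" "k + ?d \<le> card B" for q k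
  proof -
    have "k \<le> r" using that(2) rB by simp
    then show ?thesis using that ab[of k] rB by (auto simp: maya_index_iff)
  qed
  have hup: "?e (q + 1) (up ?M q x) = up (maya_module B) q (?e q x)"
    if q: "1 \<le> q \<and> q + 2 \<le> n" and x: "x \<in> grade ?M q" for q x
  proof -
    have q1: "q \<in> {1..n-1}" "q + 1 \<in> {1..n-1}" using q by auto
    note ux = up_maya_in_grade[OF x]
    have "?e (q + 1) (up ?M q x) (q', l) = up (maya_module B) q (?e q x) (q', l)" for q' l
    \<comment> \<open>In the first case the endpoint and the coordinate that is read are both
      indices, and so are the two intermediate positions. Otherwise both sides are 0.\<close>
    proof (cases "q' = q + 1 \<and> (q', l) \<in> maya_index B \<and> (q, l - 1 - ?d) \<in> maya_index A")
      case True
      then have l: "(q + 1, l) \<in> maya_index B" and k: "(q, l - 1 - ?d) \<in> maya_index A" by auto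
      let ?k = "l - 1 - ?d"
      have lk: "l = ?k + ?d + 1" and lB: "l \<le> card B" using l k by (auto simp: maya_index_iff)
      have "?k + 1 \<le> card A" using lk lB rA rB by simp
      then have "(q + 1, l - ?d) \<in> maya_index A"
        using maya_index_diag[OF fin(1) k, of 1] lk by (metis add.commute add.left_commute diff_add_inverse2)
      moreover have "(q, l - 1) \<in> maya_index B"
        using row[OF k] lk lB l k by (auto simp: maya_index_iff)
      ultimately show ?thesis
        using True q1 x ux by (simp add: up_maya[OF gr] up_maya[OF x] shift_hom_apply diff_right_commute)
    next
      case False
      then show ?thesis
        using grade_maya_zero[OF x, of q "l - 1 - ?d"]
        by (auto simp: up_maya[OF gr] up_maya[OF x] shift_hom_apply diff_right_commute)
    qed
    then show ?thesis by (simp add: fun_eq_iff)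
  qed
  have hdn: "?e (q - 1) (down ?M q x) = down (maya_module B) q (?e q x)"
    if q: "2 \<le> q \<and> q + 1 \<le> n" and x: "x \<in> grade ?M q" for q x
  proof -
    have q1: "q \<in> {1..n-1}" "q - 1 \<in> {1..n-1}" using q by auto
    note dx = down_maya_in_grade[OF x]
    have "?e (q - 1) (down ?M q x) (q', l) = down (maya_module B) q (?e q x) (q', l)" for q' l
    proof (cases "q' = q - 1 \<and> (q', l) \<in> maya_index B \<and> (q, l - ?d) \<in> maya_index A")
      case True
      then have l: "(q - 1, l) \<in> maya_index B" and k: "(q, l - ?d) \<in> maya_index A" by auto
      have "(q - 1, m) \<in> maya_index A" if "(q, m) \<in> maya_index A" "m \<le> l" for m
        using that l by (auto simp: maya_index_iff)
      then have "(q - 1, l - ?d) \<in> maya_index A" using k by simp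
      moreover have "1 \<le> l - ?d" using k by (simp add: maya_index_iff)
      then have "l - ?d + ?d = l" by linarith
      then have "(q, l) \<in> maya_index B" using row[OF k] l by (auto simp: maya_index_iff)
      ultimately show ?thesis
        using True q1 x dx by (simp add: down_maya[OF gr] down_maya[OF x] shift_hom_apply)
    next
      case False
      then show ?thesis
        using grade_maya_zero[OF x, of q "l - ?d"]
        by (auto simp: down_maya[OF gr] down_maya[OF x] shift_hom_apply)
    qed
    then show ?thesis by (simp add: fun_eq_iff)
  qed
  have zero: "?e q x = 0" if "q \<notin> {1..n-1} \<or> x \<notin> grade ?M q" for q x
    using that by (auto simp: shift_hom_def fun_eq_iff)
  show ?thesis
    unfolding Hom_Lambda_def mem_Collect_eq smul_maya
    by (intro conjI ballI allI impI) (fact lin zero hup hdn)+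
qed

lemma dim_Hom_maya:
  assumes A: "A \<subseteq> {1..n}" and B: "B \<subseteq> {1..n}" and n: "n \<ge> 2"
  shows "dim_Hom n (maya_module A :: ('k::field, nat \<times> nat \<Rightarrow> 'k) graded_rep)
      (maya_module B :: ('k, nat \<times> nat \<Rightarrow> 'k) graded_rep)
    = card {r. (card B, r) \<in> maya_index A \<and> fits A B r}"
proof -
  let ?M = "maya_module A :: ('k, nat \<times> nat \<Rightarrow> 'k) graded_rep"
  let ?N = "maya_module B :: ('k, nat \<times> nat \<Rightarrow> 'k) graded_rep"
  let ?D = "{r. (card B, r) \<in> maya_index A \<and> fits A B r}"
  let ?e = "\<lambda>r. shift_hom n A B (card B - r) :: nat \<Rightarrow> (nat \<times> nat \<Rightarrow> 'k) \<Rightarrow> _"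
  let ?\<gamma> = "\<lambda>r f. f (card B) (maya_vec A (card B) r) (card B, card B) :: 'k"
  have vs: "vector_space (smul ?N)" using vector_space_maya_smul by (simp add: smul_maya)
  interpret H: vector_space
    "hom_smul ?N :: 'k \<Rightarrow> (nat \<Rightarrow> (nat \<times> nat \<Rightarrow> 'k) \<Rightarrow> nat \<times> nat \<Rightarrow> 'k) \<Rightarrow> _"
    by (rule vector_space_hom_smul[OF vs])
  have "H.dim (Hom_Lambda n ?M ?N) = card ?D"
  proof (rule H.dim_eq_card_dual_basis[where e = ?e and \<gamma> = ?\<gamma>])
    show "H.subspace (Hom_Lambda n ?M ?N)"
      by (intro subspace_Hom_Lambda lambda_module_maya A B n)
    show "finite ?D" by (rule finite_subset[OF _ finite_maya_row[of "card B" A]]) auto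
    show "?e r \<in> Hom_Lambda n ?M ?N" if "r \<in> ?D" for r
      using shift_hom_in_Hom[OF A B] that by blast
    show "?\<gamma> r (f + g) = ?\<gamma> r f + ?\<gamma> r g" for r f g by simp
    show "?\<gamma> r (hom_smul ?N c f) = c * ?\<gamma> r f" for r c f
      by (simp add: hom_smul_def smul_maya maya_smul_def)
    show "?\<gamma> r (?e s) = (if r = s then 1 else 0)" if r: "r \<in> ?D" and s: "s \<in> ?D" for r s
    proof -
      \<comment> \<open>The case \<open>k = r\<close> of \<open>fits\<close> compares with the
        largest element of \<open>B\<close>, so the socle position is an index as soon as
        \<open>?D\<close> is nonempty.\<close>
      have "r \<in> {1..r}" using r by (auto simp: maya_index_iff)
      with r have "kth A r \<le> kth B (r + card B - r)" unfolding fits_def by blast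
      then have "kth A r \<le> kth B (card B)" by simp
      then have jj: "(card B, card B) \<in> maya_index B" using r by (auto simp: maya_index_iff)
      from maya_index_bounds[OF B this] have "card B \<in> {1..n-1}" by auto
      \<comment> \<open>As \<open>s \<le> card B\<close>, the shift by \<open>card B - s\<close>
        reads \<open>maya_vec A (card B) r\<close> at index \<open>s\<close>.\<close>
      then show ?thesis
        using jj r s maya_vec_in_grade[of A "card B" r]
        by (auto simp: shift_hom_def maya_vec_def fits_def)
    qed
    show "f = 0" if "f \<in> Hom_Lambda n ?M ?N" "\<And>r. r \<in> ?D \<Longrightarrow> ?\<gamma> r f = 0" for f
      using hom_eq_zero[OF A B that(1)] that by (simp add: hom_coeff_def[OF A B that(1)])
  qed
  then show ?thesis by (simp add: dim_Hom_def)
qed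

section \<open>Comparison of the two sides\<close>

theorem corollary3p6:
  fixes n i j :: nat and A B :: "nat set"
  assumes "n \<ge> 2"
    and "A \<subset> {1..n}" and "card A = i" and "A \<noteq> {1..i}"
    and "B \<subset> {1..n}" and "card B = j" and "B \<noteq> {1..j}"
  shows "is_maximum_on (inner_n n (indicator A)) (trunc_perm n B)
           (real (dim_Hom n (maya_module A :: ('k::field, nat \<times> nat \<Rightarrow> 'k) graded_rep)
                            (maya_module B :: ('k, nat \<times> nat \<Rightarrow> 'k) graded_rep)))"
proof -
  have A: "A \<subseteq> {1..n}" and B: "B \<subseteq> {1..n}" using assms by auto
  have fin: "finite A" "finite B" using A B finite_subset by auto
  define a where "a = card (A \<inter> {1..card B})"
  define R where "R = Max {r. fits A B r}"
  have finR: "finite {r. fits A B r}"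
    by (rule finite_subset[of _ "{..card A}"]) (auto simp: fits_def)
  have "fits A B 0" by (simp add: fits_def)
  then have R: "fits A B R" and Rmax: "\<And>r. fits A B r \<Longrightarrow> r \<le> R"
    using Max_in[OF finR] Max_ge[OF finR] unfolding R_def by auto
  \<comment> \<open>The set \<open>{1..card B}\<close> is an admissible \<open>C\<close>, so
    \<open>a \<le> R\<close> and the difference \<open>R - a\<close> is not truncated.\<close>
  have "kth {1..card B} k \<le> kth B k" if "k \<in> {1..card B}" for k
  proof -
    have "card {c\<in>{1..card B}. c \<le> k} = k"
    proof -
      have "{c\<in>{1..card B}. c \<le> k} = {1..k}" using that by auto
      then show ?thesis by simp
    qed
    then have "kth {1..card B} k \<le> k" using kth_le_iff[of "{1..card B}" k k] that by auto
    also have "k \<le> kth B k" using B fin that by (intro kth_ge) auto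
    finally show ?thesis .
  qed
  then have aR: "a \<le> R"
    unfolding a_def using fin by (intro Rmax fits_card_Int) auto
  have "{r. (card B, r) \<in> maya_index A \<and> fits A B r} = {a<..R}"
  proof (intro set_eqI iffI)
    have a: "{c\<in>A. c \<le> card B} = A \<inter> {1..card B}" using A by auto
    \<comment> \<open>By counting: the \<open>r\<close>-th element of \<open>A\<close> exceeds
      \<open>card B\<close> exactly if fewer than \<open>r\<close> elements of \<open>A\<close> do
      not. The remaining index bound \<open>r \<le> card B\<close> comes from
      \<open>fits\<close>.\<close>
    have gt: "card B < kth A r \<longleftrightarrow> a < r" if "1 \<le> r" "r \<le> card A" for r
      using kth_le_iff[OF fin(1) that, of "card B"] unfolding a a_def by auto
    fix r
    {
      assume "r \<in> {r. (card B, r) \<in> maya_index A \<and> fits A B r}"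
      then show "r \<in> {a<..R}" using gt Rmax by (auto simp: maya_index_iff)
    next
      assume "r \<in> {a<..R}"
      moreover from this have "fits A B r" using fits_mono[OF R _ fin(2)] by auto
      ultimately show "r \<in> {r. (card B, r) \<in> maya_index A \<and> fits A B r}"
        using gt[of r] by (auto simp: maya_index_iff fits_def)
    }
  qed
  then have "real (dim_Hom n (maya_module A :: ('k, nat \<times> nat \<Rightarrow> 'k) graded_rep)
      (maya_module B :: ('k, nat \<times> nat \<Rightarrow> 'k) graded_rep)) = real R - real a"
    using dim_Hom_maya[OF A B assms(1), where ?'k = 'k] aR by (simp add: of_nat_diff)
  then show ?thesis using is_maximum_on_trunc_perm[OF A B R Rmax] by (simp add: a_def)
qed

end
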